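(* Let $n\ge0$, $k\in\{2,3,4\}$ and $k\ge i\ge1$ be integers. Then \[ \sum_{n_1\geq \dots\geq n_{k-1}\geq 0} q^{n_1^2+\dots+n_{k-1}^2 + n_i+\dots +n_{k-1}} {n-\sum_{j=1}^{k-2}n_j - k +i\brack n_{k-1}}'_{q^2} \prod_{j=1}^{k-2} {2n- 2\sum_{l=1}^{j-1}n_l -n_j - n_{j+1} - 2\alpha_{ij}\brack n_j - n_{j+1}}'_q = \sum_{r=-\infty}^{\infty} (-1)^r q^{r( kr + k-i)} {2n\brack n -kr +(k-i) \frac{(-1)^r-1}{2}}_q, \] where the left sum is over integers $n_1\ge\dots\ge n_{k-1}\ge0$, empty sums are $0$ and empty products are $1$.
   Context: $\alpha_{ij}:=\max\{j-i+1,0\}$. For integers $a,b$, ${a\brack b}_q=\frac{(q;q)_a}{(q;q)_b(q;q)_{a-b}}$ if $0\le b\le a$ and $0$ otherwise, with $(x;q)_m=\prod_{j=0}^{m-1}(1-xq^j)$; ${a\brack b}'_q$ equals $1$ if $a<0$ and $b=0$, and ${a\brack b}_q$ otherwise. ${a\brack b}'_{q^2}$ is the same with $q$ replaced by $q^2$. *)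

theory Defs
  imports Main "HOL-Library.FuncSet" "HOL-Library.Groups_Big_Fun"
begin

definition q_pochhammer :: "'a::field \<Rightarrow> 'a \<Rightarrow> nat \<Rightarrow> 'a" where
  "q_pochhammer x q m = (\<Prod>j<m. 1 - x * q ^ j)"

text \<open>
  The quotient is meaningful when \<open>q\<close> is not a root of unity (this includes an indeterminate
  in a field of rational functions, and a complex number with \<open>\<bar>q\<bar> < 1\<close>): then no factor
  of the denominator vanishes.
\<close>

definition q_binomial :: "'a::field \<Rightarrow> int \<Rightarrow> int \<Rightarrow> 'a" where
  "q_binomial q a b =
     (if 0 \<le> b \<and> b \<le> a
      then q_pochhammer q q (nat a) / (q_pochhammer q q (nat b) * q_pochhammer q q (nat (a - b)))
      else 0)"

definition q_binomial' :: "'a::field \<Rightarrow> int \<Rightarrow> int \<Rightarrow> 'a" where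
  "q_binomial' q a b = (if a < 0 \<and> b = 0 then 1 else q_binomial q a b)"

definition alpha :: "int \<Rightarrow> int \<Rightarrow> int" where
  "alpha i j = max (j - i + 1) 0"

text \<open>
  Integer tuples \<open>n\<^sub>1 \<ge> \<dots> \<ge> n\<^sub>l \<ge> 0\<close>, encoded as functions on \<open>{1..l}\<close> that are
  \<open>undefined\<close> elsewhere, so that each tuple is represented exactly once.
\<close>

definition decreasing_tuples :: "int \<Rightarrow> (int \<Rightarrow> int) set" where
  "decreasing_tuples l = {m \<in> {1..l} \<rightarrow>\<^sub>E {0..}. antimono_on {1..l} m}"

text \<open>
  The constant \<open>Sum_any\<close> is the sum over the support of a function, and \<open>0\<close> if that support is
  infinite. The next two lemmas show that the supports of the two sums under consideration are
  finite.
\<close>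

lemma q_binomial_nonzeroD: "q_binomial q a b \<noteq> 0 \<Longrightarrow> 0 \<le> b \<and> b \<le> a"
  by (auto simp: q_binomial_def split: if_splits)

lemma q_binomial'_nonzeroD: "q_binomial' q a b \<noteq> 0 \<Longrightarrow> b = 0 \<or> (0 \<le> b \<and> b \<le> a)"
  by (auto simp: q_binomial'_def dest: q_binomial_nonzeroD split: if_splits)

lemma finite_support_left:
  fixes q :: "'a::field" and n k i :: int
  assumes "n \<ge> 0" "k \<ge> 2" "i \<le> k"
  shows "finite {m \<in> decreasing_tuples (k - 1).
      q_binomial' (q\<^sup>2) (n - (\<Sum>j=1..k-2. m j) - k + i) (m (k - 1)) *
      (\<Prod>j=1..k-2. q_binomial' q
         (2 * n - 2 * (\<Sum>l=1..j-1. m l) - m j - m (j + 1) - 2 * alpha i j) (m j - m (j + 1))) \<noteq> 0}"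
    (is "finite ?S")
proof (rule finite_subset)
  show "finite ({1..k-1} \<rightarrow>\<^sub>E {0..n})"
    by (intro finite_PiE) auto
  show "?S \<subseteq> {1..k-1} \<rightarrow>\<^sub>E {0..n}"
  proof
    fix m assume m: "m \<in> ?S"
    have ext: "m \<in> {1..k-1} \<rightarrow>\<^sub>E {0..}" and anti: "antimono_on {1..k-1} m"
      using m by (auto simp: decreasing_tuples_def)
    have nn: "m j \<ge> 0" if "1 \<le> j" "j \<le> k - 1" for j
      using ext that by (auto simp: PiE_iff)
    have anti': "m b \<le> m a" if "1 \<le> a" "a \<le> b" "b \<le> k - 1" for a b
      using anti that by (auto simp: monotone_on_def)
    have b1: "m (k - 1) = 0 \<or> m (k - 1) \<le> n - (\<Sum>j=1..k-2. m j) - k + i"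
      using m by (auto dest!: q_binomial'_nonzeroD)
    have b2: "m j = m (j + 1) \<or>
        m j - m (j + 1) \<le> 2 * n - 2 * (\<Sum>l=1..j-1. m l) - m j - m (j + 1) - 2 * alpha i j"
      if "1 \<le> j" "j \<le> k - 2" for j
      using m that by (auto dest!: q_binomial'_nonzeroD)
    have step: "m j = m (j + 1) \<or> m j \<le> n" if "1 \<le> j" "j \<le> k - 2" for j
    proof -
      have "(\<Sum>l=1..j-1. m l) \<ge> 0"
        using that by (intro sum_nonneg nn) auto
      moreover have "alpha i j \<ge> 0"
        by (simp add: alpha_def)
      ultimately show ?thesis
        using b2[OF that] by linarith
    qed
    have eq: "j \<le> k - 1 \<longrightarrow> m j = m 1 \<or> m 1 \<le> n" if "1 \<le> j" for j
      using that
    proof (induction j rule: int_ge_induct)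
      case (step j)
      then show ?case using \<open>1 \<le> j\<close> \<open>\<And>j. 1 \<le> j \<Longrightarrow> j \<le> k - 2 \<Longrightarrow> m j = m (j + 1) \<or> m j \<le> n\<close>[of j]
        by auto
    qed simp
    have "m (k - 1) \<le> n"
    proof -
      have "(\<Sum>j=1..k-2. m j) \<ge> 0"
        by (intro sum_nonneg nn) auto
      with b1 assms show ?thesis by linarith
    qed
    then have "m 1 \<le> n"
      using eq[of "k - 1"] assms by auto
    then have "m j \<le> n" if "1 \<le> j" "j \<le> k - 1" for j
      using anti'[of 1 j] that by simp
    then show "m \<in> {1..k-1} \<rightarrow>\<^sub>E {0..n}"
      using ext nn by (auto simp: PiE_iff)
  qed
qed

lemma finite_support_right:
  fixes q :: "'a::field" and n k i :: int
  assumes "k \<ge> 1" "1 \<le> i" "i \<le> k"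
  shows "finite {r :: int.
      q_binomial q (2 * n) (n - k * r + (k - i) * (((-1) ^ nat \<bar>r\<bar> - 1) div 2)) \<noteq> 0}"
    (is "finite ?S")
proof (rule finite_subset)
  show "finite {-(\<bar>n\<bar> + k)..\<bar>n\<bar> + k}" by simp
  show "?S \<subseteq> {-(\<bar>n\<bar> + k)..\<bar>n\<bar> + k}"
  proof
    fix r :: int assume "r \<in> ?S"
    then have b: "0 \<le> n - k * r + (k - i) * (((-1) ^ nat \<bar>r\<bar> - 1) div 2)"
      "n - k * r + (k - i) * (((-1) ^ nat \<bar>r\<bar> - 1) div 2) \<le> 2 * n"
      by (auto dest: q_binomial_nonzeroD)
    have e: "(k - i) * (((-1) ^ nat \<bar>r\<bar> - 1) div 2) \<in> {0, -(k - i)}"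
      by (cases "even (nat \<bar>r\<bar>)") auto
    have "\<bar>k * r\<bar> \<le> \<bar>n\<bar> + k"
      using b e assms by auto
    moreover have "\<bar>r\<bar> \<le> \<bar>k * r\<bar>"
      using assms by (simp add: abs_mult mult_le_cancel_right1)
    ultimately show "r \<in> {-(\<bar>n\<bar> + k)..\<bar>n\<bar> + k}" by auto
  qed
qed

end

theory Submission
  imports Defs "HOL-Library.Disjoint_Sets"
begin

text \<open>
  Write \<open>[a, b]\<close> for the Gaussian binomial coefficient to base \<open>q\<close>. The innermost factor is an
  alternating sum of products to base \<open>q\<close>, namely
  \<open>[N, M]\<close> to base \<open>q\<^sup>2\<close> equals \<open>\<Sum>b. (-1)\<^sup>b q powi b\<^sup>2 [N, M - b] [N, M + b]\<close>.
  Now carry out the summations over \<open>n\<^sub>k\<^sub>-\<^sub>1, \<dots>, n\<^sub>2\<close> in this order. With \<open>M = n\<^sub>j\<close>,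
  \<open>m = n\<^sub>j\<^sub>+\<^sub>1\<close> and \<open>L = n - n\<^sub>1 - \<dots> - n\<^sub>j - \<alpha>\<^sub>i\<^sub>j\<close> the factor linking consecutive variables is
  \<open>[2 L + M - m, M - m]\<close>, and the summation over \<open>m\<close> is for each \<open>b\<close> an instance of the
  q-Saalschuetz sum, which turns a product of two binomial coefficients into another such
  product. For \<open>n\<^sub>j\<close> with \<open>j \<ge> i\<close>, which carry the weight \<open>q powi (m\<^sup>2 + m)\<close>, the alternating
  sum must first be rewritten by Pascal's rule, where the surplus terms cancel in pairs. The
  last summation, over \<open>n\<^sub>1\<close>, is a q-Vandermonde sum and leaves a single binomial coefficient.
\<close>

section \<open>Sums over all indices\<close>

lemma Sum_any_mult_left: "r * Sum_any g = (\<Sum>n. r * g n)"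
  for r :: "'a::semiring_no_zero_divisors"
  by (cases "r = 0") (simp_all add: Sum_any.expand_set sum_distrib_left)

lemma Sum_any_mult_right: "Sum_any g * r = (\<Sum>n. g n * r)"
  for r :: "'a::semiring_no_zero_divisors"
  by (cases "r = 0") (simp_all add: Sum_any.expand_set sum_distrib_right)

lemma Sum_any_shift: "(\<Sum>i. f (i + d)) = (\<Sum>i. f i)" for d :: "'b::group_add"
  by (rule Sum_any.reindex_cong[symmetric, of "\<lambda>i. i + d"])
    (auto intro!: o_bij[of "\<lambda>i. i - d"] simp: fun_eq_iff)

lemma Sum_any_reflect: "(\<Sum>i. f (d - i)) = (\<Sum>i. f i)" for d :: "'b::ab_group_add"
  by (rule Sum_any.reindex_cong[symmetric, of "\<lambda>i. d - i"])
    (auto intro!: o_bij[of "\<lambda>i. d - i"] simp: fun_eq_iff)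

lemma Sum_any_diff:
  fixes f g :: "'b \<Rightarrow> 'c::ab_group_add"
  assumes "finite {b. f b \<noteq> 0}" "finite {b. g b \<noteq> 0}"
  shows "(\<Sum>b. f b - g b) = Sum_any f - Sum_any g"
  using Sum_any.distrib[of "\<lambda>b. f b - g b" g] assms
    finite_subset[of "{b. f b - g b \<noteq> 0}" "{b. f b \<noteq> 0} \<union> {b. g b \<noteq> 0}"] by force

lemma sum_Sum_any_swap:
  assumes "\<And>m. m \<in> A \<Longrightarrow> finite {b. f m b \<noteq> 0}"
  shows "(\<Sum>m\<in>A. \<Sum>b. f m b) = (\<Sum>b. \<Sum>m\<in>A. f m b)"
proof (cases "finite A")
  case True
  define B where "B = (\<Union>m\<in>A. {b. f m b \<noteq> 0})"
  have "finite B"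
    using True assms by (simp add: B_def)
  have "(\<Sum>m\<in>A. \<Sum>b. f m b) = (\<Sum>m\<in>A. \<Sum>b\<in>B. f m b)"
    by (intro sum.cong Sum_any.expand_superset \<open>finite B\<close>) (auto simp: B_def)
  also have "\<dots> = (\<Sum>b\<in>B. \<Sum>m\<in>A. f m b)"
    by (rule sum.swap)
  also have "\<dots> = (\<Sum>b. \<Sum>m\<in>A. f m b)"
    by (rule Sum_any.expand_superset[symmetric, OF \<open>finite B\<close>])
      (auto simp: B_def dest: sum.not_neutral_contains_not_neutral)
  finally show ?thesis .
qed simp

lemma Sum_any_involution_eq_0:
  fixes h :: "'b \<Rightarrow> 'c::ab_group_add"
  assumes "\<And>b. f (f b) = b" "\<And>b. f b \<noteq> b" "\<And>b. h (f b) = - h b"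
  shows "Sum_any h = 0"
  unfolding Sum_any.expand_set by (rule sum_involution_eq_0[where h = f]) (auto simp: assms)

section \<open>Gaussian binomial coefficients\<close>

locale generic_base =
  fixes q :: "'a::field"
  assumes q_nonzero: "q \<noteq> 0"
    and not_root_of_unity: "m > 0 \<Longrightarrow> q ^ m \<noteq> 1"
begin

abbreviation qpoch :: "nat \<Rightarrow> 'a" where
  "qpoch \<equiv> q_pochhammer q q"

abbreviation qbinom :: "int \<Rightarrow> int \<Rightarrow> 'a" where
  "qbinom \<equiv> q_binomial q"

lemma q_powi_add: "q powi (a + b) = q powi a * q powi b"
  by (simp add: power_int_add q_nonzero)

lemma qpoch_0 [simp]: "qpoch 0 = 1"
  by (simp add: q_pochhammer_def)

lemma qpoch_Suc: "qpoch (Suc n) = qpoch n * (1 - q ^ Suc n)"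
  by (simp add: q_pochhammer_def)

lemma qpoch_nonzero [simp]: "qpoch n \<noteq> 0"
proof (induction n)
  case (Suc n)
  have "q ^ Suc n \<noteq> 1" by (rule not_root_of_unity) simp
  with Suc show ?case by (simp add: qpoch_Suc del: power_Suc)
qed simp

lemma qbinom_eq_0: "b < 0 \<or> a < b \<Longrightarrow> qbinom a b = 0"
  by (auto simp: q_binomial_def)

lemma qbinom_negative [simp]: "a < 0 \<Longrightarrow> qbinom a b = 0"
  by (auto simp: q_binomial_def)

lemma qbinom_0 [simp]: "0 \<le> a \<Longrightarrow> qbinom a 0 = 1"
  by (simp add: q_binomial_def)

lemma qbinom_self [simp]: "0 \<le> a \<Longrightarrow> qbinom a a = 1"
  by (simp add: q_binomial_def)

lemma qbinom_0_left: "qbinom 0 b = (if b = 0 then 1 else 0)"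
  by (auto simp: q_binomial_def)

lemma qbinom_of_nat: "qbinom (int (m + n)) (int m) = qpoch (m + n) / (qpoch m * qpoch n)"
  by (simp add: q_binomial_def nat_add_distrib)

lemma qbinom_symmetric: "qbinom a b = qbinom a (a - b)"
  by (auto simp: q_binomial_def mult.commute)

lemma finite_qbinom_support: "finite {b. qbinom a b \<noteq> 0}"
  by (rule finite_subset[of _ "{0..a}"]) (auto dest: q_binomial_nonzeroD)

lemma qbinom_pascal_left:
  assumes "a \<noteq> -1 \<or> b \<noteq> 0"
  shows "qbinom (a + 1) b = qbinom a (b - 1) + q powi b * qbinom a b"
proof -
  consider "b < 0 \<or> a + 1 < b" | "b = 0" "a < 0" | "b = 0" "a \<ge> 0" | "b = a + 1" "b > 0"
    | "1 \<le> b" "b \<le> a"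
    by linarith
  then show ?thesis
  proof cases
    case 5
    then have "b = int (Suc (nat (b - 1)))" "a = int (Suc (nat (b - 1)) + nat (a - b))"
      by simp_all
    then obtain m n where b: "b = int (Suc m)" and a: "a = int (Suc m + n)"
      by blast
    have "qbinom (a + 1) b = qpoch (Suc m + Suc n) / (qpoch (Suc m) * qpoch (Suc n))"
      using qbinom_of_nat[of "Suc m" "Suc n"] a b by (simp add: ac_simps)
    moreover have "qbinom a (b - 1) = qpoch (m + Suc n) / (qpoch m * qpoch (Suc n))"
      using qbinom_of_nat[of m "Suc n"] a b by (simp add: ac_simps)
    moreover have "qbinom a b = qpoch (Suc m + n) / (qpoch (Suc m) * qpoch n)"
      using qbinom_of_nat[of "Suc m" n] a b by simp
    moreover have "q powi b = q ^ Suc m"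
      unfolding b power_int_of_nat ..
    moreover have "q ^ Suc m \<noteq> 1" "q ^ Suc n \<noteq> 1"
      using not_root_of_unity by blast+
    moreover have "qpoch (Suc m + Suc n) = qpoch (Suc m + n) * (1 - q ^ Suc m * q ^ Suc n)"
      by (simp add: qpoch_Suc power_add ac_simps)
    moreover have "m + Suc n = Suc m + n" by simp
    ultimately show ?thesis
      by (simp only:)
        (simp add: qpoch_Suc[of m] qpoch_Suc[of n] divide_simps del: power_Suc,
          simp add: algebra_simps)
  qed (use assms in \<open>auto simp: qbinom_eq_0\<close>)
qed

lemma qbinom_pascal_right:
  assumes "a \<noteq> -1 \<or> b \<noteq> 0"
  shows "qbinom (a + 1) b = qbinom a b + q powi (a + 1 - b) * qbinom a (b - 1)"
proof -
  have "qbinom (a + 1) b = qbinom (a + 1) (a + 1 - b)"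
    by (rule qbinom_symmetric)
  also have "\<dots> = qbinom a (a - b) + q powi (a + 1 - b) * qbinom a (a - (b - 1))"
    using qbinom_pascal_left[of a "a + 1 - b"] assms by (auto simp: algebra_simps)
  finally show ?thesis
    unfolding qbinom_symmetric[symmetric] .
qed

lemma qbinom_mult_cancel:
  assumes "0 \<le> c"
  shows "qbinom a b * qbinom b c = qbinom a c * qbinom (a - c) (b - c)"
proof (cases "c \<le> b \<and> b \<le> a")
  case True
  with assms show ?thesis by (simp add: q_binomial_def)
qed (use assms in \<open>auto simp: qbinom_eq_0 not_le\<close>)

lemma qbinom_mult_swap:
  assumes "0 \<le> m" "0 \<le> j" "0 \<le> c"
  shows "qbinom (m + c) (m - j) * qbinom (b + m) (m + c) =
    qbinom (b + m) (m - j) * qbinom (b + j) (c + j)"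
proof (cases "j \<le> m \<and> c \<le> b")
  case True
  with assms show ?thesis by (simp add: q_binomial_def)
qed (use assms in \<open>auto simp: qbinom_eq_0 not_le\<close>)

section \<open>The q-Vandermonde and q-Saalschuetz sums\<close>

definition vandermonde_summand :: "int \<Rightarrow> int \<Rightarrow> int \<Rightarrow> int \<Rightarrow> 'a" where
  "vandermonde_summand a b w u = q powi (u * (b - w + u)) * (qbinom a u * qbinom b (w - u))"

lemma finite_vandermonde_summand: "finite {u. vandermonde_summand a b w u \<noteq> 0}"
  by (rule finite_subset[OF _ finite_qbinom_support[of a]]) (auto simp: vandermonde_summand_def)

lemma vandermonde_summand_Suc:
  assumes "0 \<le> a"
  shows "vandermonde_summand (a + 1) b w u =
    vandermonde_summand a b w u + q powi (a + b + 1 - w) * vandermonde_summand a b (w - 1) (u - 1)"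
proof -
  have pascal: "qbinom (a + 1) u = qbinom a u + q powi (a + 1 - u) * qbinom a (u - 1)"
    by (rule qbinom_pascal_right) (use assms in auto)
  have "q powi (u * (b - w + u)) * q powi (a + 1 - u) =
      q powi (a + b + 1 - w) * q powi ((u - 1) * (b - (w - 1) + (u - 1)))"
    unfolding q_powi_add[symmetric] by (simp add: algebra_simps)
  then show ?thesis
    unfolding pascal vandermonde_summand_def by (simp add: algebra_simps)
qed

lemma q_vandermonde:
  assumes "0 \<le> a" "0 \<le> b"
  shows "(\<Sum>u. vandermonde_summand a b w u) = qbinom (a + b) w"
  using assms(1)
proof (induction a arbitrary: w rule: int_ge_induct)
  case base
  have "(\<Sum>u. vandermonde_summand 0 b w u) = (\<Sum>u::int. if u = 0 then qbinom b w else 0)"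
    by (rule Sum_any.cong) (simp add: vandermonde_summand_def qbinom_0_left)
  then show ?case by simp
next
  case (step a)
  let ?c = "q powi (a + b + 1 - w)"
  have "{u. ?c * vandermonde_summand a b (w - 1) (u - 1) \<noteq> 0} \<subseteq>
      (\<lambda>u. u + 1) ` {u. vandermonde_summand a b (w - 1) u \<noteq> 0}"
    by (force simp: image_iff)
  then have "(\<Sum>u. vandermonde_summand (a + 1) b w u) =
      (\<Sum>u. vandermonde_summand a b w u) + ?c * (\<Sum>u. vandermonde_summand a b (w - 1) (u - 1))"
    unfolding vandermonde_summand_Suc[OF step.hyps] Sum_any_mult_left
    by (intro Sum_any.distrib finite_vandermonde_summand
        finite_subset[OF _ finite_imageI[OF finite_vandermonde_summand]])
  also have "(\<Sum>u. vandermonde_summand a b (w - 1) (u - 1)) =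
      (\<Sum>u. vandermonde_summand a b (w - 1) u)"
    using Sum_any_shift[of "vandermonde_summand a b (w - 1)" "- 1"] by simp
  also have "(\<Sum>u. vandermonde_summand a b w u) + ?c * (\<Sum>u. vandermonde_summand a b (w - 1) u) =
      qbinom (a + b) w + ?c * qbinom (a + b) (w - 1)"
    by (simp only: step.IH)
  also have "\<dots> = qbinom (a + b + 1) w"
    by (rule qbinom_pascal_right[symmetric]) (use step.hyps assms(2) in auto)
  finally show ?case by (simp add: ac_simps)
qed

lemma q_vandermonde_centred:
  assumes "0 \<le> a \<or> d + c \<le> 0" "0 \<le> b \<or> 0 \<le> d + c"
  shows "(\<Sum>i. q powi ((i - d) * (i + c)) * (qbinom a (i - d) * qbinom b (i + c))) =
    qbinom (a + b) (b - d - c)"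
proof (cases "0 \<le> a \<and> 0 \<le> b")
  case True
  have "q powi ((i - d) * (i + c)) * (qbinom a (i - d) * qbinom b (i + c)) =
      vandermonde_summand a b (b - d - c) (i + - d)" for i
    unfolding vandermonde_summand_def by (subst (2) qbinom_symmetric) (simp add: algebra_simps)
  then show ?thesis
    using True by (simp only: Sum_any_shift q_vandermonde)
next
  case False
  then have "qbinom a (i - d) * qbinom b (i + c) = 0" for i
    by (auto simp: not_le)
  with False assms show ?thesis
    by (auto simp: qbinom_eq_0)
qed

lemma q_vandermonde_weighted:
  assumes "0 \<le> b"
  shows "(\<Sum>j. q powi ((j - i) * (b - m + j)) * (qbinom a j * qbinom j i * qbinom b (m - j))) =
    qbinom a i * qbinom (a + b - i) (m - i)"
proof (cases "0 \<le> i \<and> i \<le> a")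
  case True
  have "q powi ((j - i) * (b - m + j)) * (qbinom a j * qbinom j i * qbinom b (m - j)) =
      qbinom a i * vandermonde_summand (a - i) b (m - i) (j + - i)" for j
    using True by (simp add: vandermonde_summand_def qbinom_mult_cancel algebra_simps)
  then have "(\<Sum>j. q powi ((j - i) * (b - m + j)) * (qbinom a j * qbinom j i * qbinom b (m - j))) =
      qbinom a i * (\<Sum>j. vandermonde_summand (a - i) b (m - i) (j + - i))"
    unfolding Sum_any_mult_left by (rule Sum_any.cong)
  also have "\<dots> = qbinom a i * qbinom (a - i + b) (m - i)"
    using True assms by (simp only: Sum_any_shift q_vandermonde diff_ge_0_iff_ge)
  finally show ?thesis by (simp add: algebra_simps)
next
  case False
  then have vanish: "qbinom a j * qbinom j i = 0" for j
    by (cases "j \<le> a") (auto simp: qbinom_eq_0)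
  show ?thesis
    unfolding vanish using False by (auto simp: qbinom_eq_0)
qed

lemma qbinom_add_expand:
  assumes "0 \<le> j" "0 \<le> b"
  shows "qbinom (b + j) (c + j) =
    (\<Sum>i. q powi ((j - i) * (b - c - i)) * (qbinom j i * qbinom b (i + c)))"
proof -
  have "q powi ((j - i) * (b - c - i)) * (qbinom j i * qbinom b (i + c)) =
      vandermonde_summand j b (c + j) (j - i)" for i
    unfolding vandermonde_summand_def by (subst qbinom_symmetric) (simp add: algebra_simps)
  then show ?thesis
    using assms by (simp only: Sum_any_reflect q_vandermonde add.commute[of b j])
qed

lemma qbinom_mult_expand:
  assumes "0 \<le> m" "0 \<le> j" "0 \<le> b" "0 \<le> c"
  shows "qbinom (m + c) (m - j) * qbinom (b + m) (m + c) =
    (\<Sum>i. q powi ((j - i) * (b - c - i)) * (qbinom (b + m) (m - j) * qbinom j i * qbinom b (i + c)))"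
  unfolding qbinom_mult_swap[OF assms(1,2,4)] qbinom_add_expand[OF assms(2,3)] Sum_any_mult_left
  by (simp only: mult_ac)

definition saalschuetz_kernel :: "int \<Rightarrow> int \<Rightarrow> int \<Rightarrow> int \<Rightarrow> int \<Rightarrow> int \<Rightarrow> 'a" where
  "saalschuetz_kernel a b c m j i = q powi (j * (j + c)) * q powi ((j - i) * (b - c - i)) *
     (qbinom a j * qbinom (b + m) (m - j) * qbinom j i * qbinom b (i + c))"

lemma sum_saalschuetz_kernel_row:
  assumes "0 \<le> b" "0 \<le> c" "0 \<le> m"
  shows "(\<Sum>i. saalschuetz_kernel a b c m j i) =
    vandermonde_summand a (m + c) m j * qbinom (b + m) (m + c)"
proof (cases "0 \<le> j")
  case True
  have "vandermonde_summand a (m + c) m j * qbinom (b + m) (m + c) =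
      q powi (j * (j + c)) * qbinom a j * (qbinom (m + c) (m - j) * qbinom (b + m) (m + c))"
    by (simp add: vandermonde_summand_def add.commute)
  also have "\<dots> = (\<Sum>i. saalschuetz_kernel a b c m j i)"
    unfolding qbinom_mult_expand[OF assms(3) True assms(1,2)] Sum_any_mult_left
    by (simp only: saalschuetz_kernel_def mult_ac)
  finally show ?thesis ..
qed (simp add: saalschuetz_kernel_def vandermonde_summand_def qbinom_eq_0)

lemma sum_saalschuetz_kernel_column:
  assumes "0 \<le> b + m"
  shows "(\<Sum>j. saalschuetz_kernel a b c m j i) = q powi (i * (i + c)) *
    (qbinom (a + b + m - i) (m - i) * qbinom a i * qbinom b (i + c))"
proof -
  have "saalschuetz_kernel a b c m j i = q powi (i * (i + c)) * qbinom b (i + c) *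
      (q powi ((j - i) * (b + m - m + j)) *
       (qbinom a j * qbinom j i * qbinom (b + m) (m - j)))" for j
  proof -
    have "q powi (j * (j + c)) * q powi ((j - i) * (b - c - i)) =
        q powi (i * (i + c)) * q powi ((j - i) * (b + m - m + j))"
      unfolding q_powi_add[symmetric] by (simp add: algebra_simps)
    then show ?thesis
      unfolding saalschuetz_kernel_def by (simp only: mult_ac)
  qed
  then have "(\<Sum>j. saalschuetz_kernel a b c m j i) = q powi (i * (i + c)) * qbinom b (i + c) *
      (qbinom a i * qbinom (a + (b + m) - i) (m - i))"
    by (simp only: Sum_any_mult_left[symmetric] q_vandermonde_weighted[OF assms])
  then show ?thesis by (simp add: algebra_simps)
qed

lemma q_saalschuetz_nonneg:
  assumes "0 \<le> a" "0 \<le> b" "0 \<le> c" "0 \<le> m"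
  shows "(\<Sum>i. q powi (i * (i + c)) *
      (qbinom (a + b + m - i) (m - i) * qbinom a i * qbinom b (i + c))) =
    qbinom (a + m + c) m * qbinom (b + m) (m + c)"
proof -
  let ?F = "saalschuetz_kernel a b c m"
  have supported: "j \<in> {0..a} \<and> i \<in> {0..a}" if "?F j i \<noteq> 0" for j i
    using that by (auto simp: saalschuetz_kernel_def dest!: q_binomial_nonzeroD)
  have "qbinom (a + m + c) m * qbinom (b + m) (m + c) =
      (\<Sum>j. vandermonde_summand a (m + c) m j) * qbinom (b + m) (m + c)"
    using assms by (simp add: q_vandermonde add.assoc)
  also have "\<dots> = (\<Sum>j. \<Sum>i. ?F j i)"
    using assms by (simp only: Sum_any_mult_right sum_saalschuetz_kernel_row)
  also have "\<dots> = (\<Sum>i. \<Sum>j. ?F j i)"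
    by (rule Sum_any.swap[of "{0..a} \<times> {0..a}"]) (use supported in auto)
  finally show ?thesis
    using assms by (simp add: sum_saalschuetz_kernel_column)
qed

lemma q_saalschuetz_shifted:
  assumes "0 \<le> a" "0 \<le> b" "0 \<le> d + c"
  shows "(\<Sum>i. q powi ((i - d) * (i + c)) *
      (qbinom (a + b + m - i) (m - i) * qbinom a (i - d) * qbinom b (i + c))) =
    qbinom (a + m + c) (m - d) * qbinom (b + m - d) (m + c)"
proof (cases "d \<le> m")
  case True
  let ?f = "\<lambda>i. q powi (i * (i + (d + c))) *
    (qbinom (a + b + (m - d) - i) (m - d - i) * qbinom a i * qbinom b (i + (d + c)))"
  have "(\<Sum>i. q powi ((i - d) * (i + c)) *
      (qbinom (a + b + m - i) (m - i) * qbinom a (i - d) * qbinom b (i + c))) = (\<Sum>i. ?f (i + - d))"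
    by (rule Sum_any.cong) (simp add: algebra_simps)
  also have "\<dots> = qbinom (a + (m - d) + (d + c)) (m - d) * qbinom (b + (m - d)) (m - d + (d + c))"
    unfolding Sum_any_shift[of ?f "- d"] by (rule q_saalschuetz_nonneg) (use assms True in auto)
  finally show ?thesis by (simp add: algebra_simps)
next
  case False
  then have vanish: "qbinom (a + b + m - i) (m - i) * qbinom a (i - d) = 0" for i
    by (cases "i \<le> m") (auto simp: qbinom_eq_0)
  show ?thesis
    unfolding vanish using False by (simp add: qbinom_eq_0)
qed

text \<open>The hypotheses make both sides zero when \<open>a\<close> or \<open>b\<close> is negative.\<close>

lemma q_saalschuetz:
  assumes "0 \<le> a \<or> d + c \<le> 0" "0 \<le> b \<or> 0 \<le> d + c"
  shows "(\<Sum>i. q powi ((i - d) * (i + c)) *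
      (qbinom (a + b + m - i) (m - i) * qbinom a (i - d) * qbinom b (i + c))) =
    qbinom (a + m + c) (m - d) * qbinom (b + m - d) (m + c)"
proof -
  consider "0 \<le> a" "0 \<le> b" "0 \<le> d + c" | "0 \<le> a" "0 \<le> b" "d + c \<le> 0" | "a < 0" | "b < 0"
    by linarith
  then show ?thesis
  proof cases
    case 1
    then show ?thesis by (rule q_saalschuetz_shifted)
  next
    case 2
    then show ?thesis
      using q_saalschuetz_shifted[of b a "- c" "- d" m] by (simp add: algebra_simps)
  next
    case 3
    with assms show ?thesis
      by (cases "m - d \<le> a + m + c") (auto simp: qbinom_eq_0)
  next
    case 4
    with assms show ?thesis
      by (cases "m + c \<le> b + m - d") (auto simp: qbinom_eq_0)
  qed
qed

end

section \<open>Alternating sums of products of two Gaussian binomial coefficients\<close>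

definition even_ceil :: "int \<Rightarrow> int" where
  "even_ceil b = (if even b then b else b + 1)"

lemma even_ceil_bounds: "b \<le> even_ceil b" "even_ceil b \<le> b + 1"
  by (simp_all add: even_ceil_def)

lemma even_ceil_reflect: "even_ceil (-1 - b) = - even_ceil b"
  by (simp add: even_ceil_def)

lemma even_ceil_nonneg: "0 \<le> b \<Longrightarrow> 0 \<le> even_ceil b"
  by (simp add: even_ceil_def)

lemma even_ceil_nonpos: "b \<le> 0 \<Longrightarrow> even_ceil b \<le> 0"
  by (auto simp: even_ceil_def) presburger

definition upper_shift :: "int \<Rightarrow> int \<Rightarrow> int \<Rightarrow> int" where
  "upper_shift s t b = s * even_ceil b + t * b"

lemma upper_shift_nonneg: "0 \<le> s \<Longrightarrow> 0 \<le> t \<Longrightarrow> 0 \<le> b \<Longrightarrow> 0 \<le> upper_shift s t b"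
  using even_ceil_nonneg[of b] by (simp add: upper_shift_def)

lemma upper_shift_nonpos: "0 \<le> s \<Longrightarrow> 0 \<le> t \<Longrightarrow> b \<le> 0 \<Longrightarrow> upper_shift s t b \<le> 0"
  using even_ceil_nonpos[of b] by (simp add: upper_shift_def add_nonpos_nonpos mult_nonneg_nonpos)

lemma upper_shift_eq_0_iff:
  assumes "0 \<le> s" "0 < t"
  shows "upper_shift s t b = 0 \<longleftrightarrow> b = 0"
proof -
  have "upper_shift s t b = upper_shift s (t - 1) b + b"
    by (simp add: upper_shift_def algebra_simps)
  moreover have "upper_shift s t 0 = 0"
    by (simp add: upper_shift_def even_ceil_def)
  ultimately show ?thesis
    using upper_shift_nonneg[of s "t - 1" b] upper_shift_nonpos[of s "t - 1" b] assms by force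
qed

lemma raised_upper_shift_bounds:
  assumes "e \<in> {0, 1}" "0 \<le> N" "0 \<le> s" "0 \<le> t"
  shows "0 \<le> b \<Longrightarrow> 0 \<le> N + upper_shift (s + e) (t - e) b"
    and "b < 0 \<Longrightarrow> upper_shift (s + e) (t - e) b \<le> N + 2 * e"
proof -
  have shift: "upper_shift (s + e) (t - e) b = upper_shift s t b + e * (even_ceil b - b)"
    by (simp add: upper_shift_def algebra_simps)
  show "0 \<le> N + upper_shift (s + e) (t - e) b" if "0 \<le> b"
    unfolding shift using upper_shift_nonneg[of s t b] even_ceil_bounds[of b] that assms by auto
  show "upper_shift (s + e) (t - e) b \<le> N + 2 * e" if "b < 0"
    unfolding shift using upper_shift_nonpos[of s t b] even_ceil_bounds[of b] that assms by auto
qed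

definition bosonic_exponent :: "int \<Rightarrow> int \<Rightarrow> int \<Rightarrow> int" where
  "bosonic_exponent s t b = (s + t + 1) * b\<^sup>2 + s * b"

lemma bosonic_exponent_reflect: "bosonic_exponent s 0 (-1 - b) = bosonic_exponent s 0 b + 2 * b + 1"
  by (simp add: bosonic_exponent_def algebra_simps power2_eq_square)

lemma bosonic_exponent_step:
  "bosonic_exponent s t b + b\<^sup>2 + e * b = bosonic_exponent (s + e) (t + 1 - e) b"
  by (simp add: bosonic_exponent_def algebra_simps)

context generic_base
begin

definition alternating_summand ::
    "(int \<Rightarrow> int) \<Rightarrow> (int \<Rightarrow> int) \<Rightarrow> int \<Rightarrow> int \<Rightarrow> int \<Rightarrow> int \<Rightarrow> int \<Rightarrow> 'a" where
  "alternating_summand g x d e N M b = (-1) powi b * q powi g b *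
     (qbinom (N + x b) (M - b) * qbinom (N + d - x b) (M + b + e))"

definition alternating_sum ::
    "(int \<Rightarrow> int) \<Rightarrow> (int \<Rightarrow> int) \<Rightarrow> int \<Rightarrow> int \<Rightarrow> int \<Rightarrow> int \<Rightarrow> 'a" where
  "alternating_sum g x d e N M = (\<Sum>b. alternating_summand g x d e N M b)"

lemma finite_alternating_summand: "finite {b. alternating_summand g x d e N M b \<noteq> 0}"
  by (rule finite_subset[of _ "{-M - e..M}"])
    (auto simp: alternating_summand_def dest!: q_binomial_nonzeroD)

lemma alternating_sum_odd_eq_0:
  assumes "odd e" "\<And>b. g (- e - b) = g b" "\<And>b. x (- e - b) = - x b"
  shows "alternating_sum g x 0 e N M = 0"
  unfolding alternating_sum_def
proof (rule Sum_any_involution_eq_0[of "\<lambda>b. - e - b"])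
  show "- e - b \<noteq> b" for b
    using assms(1) by presburger
  show "alternating_summand g x 0 e N M (- e - b) = - alternating_summand g x 0 e N M b" for b
    using assms by (auto simp: alternating_summand_def power_int_minus_left algebra_simps)
qed simp

lemma alternating_sum_raise_lower:
  assumes "\<And>b. g (-1 - b) = g b + 2 * b + 1" "\<And>b. x (-1 - b) = - x b"
    and "\<And>b. b < 0 \<Longrightarrow> x b \<le> N"
  shows "alternating_sum g x 1 1 N M = alternating_sum g x 0 0 N M"
proof -
  let ?g = "\<lambda>b. g b + (M + b + 1)"
  have "alternating_summand g x 1 1 N M b =
      alternating_summand g x 0 0 N M b + alternating_summand ?g x 0 1 N M b" for b
  proof (cases "M < b")
    case True
    then show ?thesis by (simp add: alternating_summand_def qbinom_eq_0)
  next
    case False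
    have "N - x b \<noteq> -1 \<or> M + b + 1 \<noteq> 0"
      using False assms(3)[of b] by linarith
    then have "qbinom (N - x b + 1) (M + b + 1) =
        qbinom (N - x b) (M + b) + q powi (M + b + 1) * qbinom (N - x b) (M + b + 1)"
      using qbinom_pascal_left[of "N - x b" "M + b + 1"] by simp
    then show ?thesis
      by (simp add: alternating_summand_def q_powi_add algebra_simps)
  qed
  then have "alternating_sum g x 1 1 N M =
      (\<Sum>b. alternating_summand g x 0 0 N M b + alternating_summand ?g x 0 1 N M b)"
    unfolding alternating_sum_def by (rule Sum_any.cong)
  also have "\<dots> = alternating_sum g x 0 0 N M + alternating_sum ?g x 0 1 N M"
    unfolding alternating_sum_def by (rule Sum_any.distrib) (rule finite_alternating_summand)+
  also have "alternating_sum ?g x 0 1 N M = 0"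
    by (rule alternating_sum_odd_eq_0) (use assms in auto)
  finally show ?thesis by simp
qed

lemma alternating_summand_raise_right:
  assumes "b < 0 \<Longrightarrow> x b \<le> N"
  shows "alternating_summand g x 2 1 N M b = alternating_summand g x 1 1 N M b +
    alternating_summand (\<lambda>b. g b + (N + 1 - x b - M - b)) x 1 0 N M b"
proof (cases "M < b")
  case True
  then show ?thesis by (simp add: alternating_summand_def qbinom_eq_0)
next
  case False
  then have "N + 1 - x b \<noteq> -1 \<or> M + b + 1 \<noteq> 0"
    using assms by linarith
  then have "qbinom (N + 1 - x b + 1) (M + b + 1) = qbinom (N + 1 - x b) (M + b + 1) +
      q powi (N + 1 - x b - M - b) * qbinom (N + 1 - x b) (M + b)"
    using qbinom_pascal_right[of "N + 1 - x b" "M + b + 1"] by (simp add: algebra_simps)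
  moreover have "q powi (g b + (N + 1 - x b - M - b)) = q powi g b * q powi (N + 1 - x b - M - b)"
    by (rule q_powi_add)
  ultimately show ?thesis
    by (simp add: alternating_summand_def algebra_simps)
qed

lemma alternating_summand_raise_left:
  assumes "0 \<le> b \<Longrightarrow> 0 \<le> N + x b" "x (b + 1) = x b" "g (b + 1) = g b + 2 * x b + 2 * b + 1"
  shows "alternating_summand g (\<lambda>b. x b + 1) 2 1 N M b = alternating_summand g x 1 1 N M b -
    alternating_summand (\<lambda>b. g b + (N + 1 - x b - M - b)) x 1 0 N M (b + 1)"
proof (cases "M + b + 1 < 0")
  case True
  then show ?thesis by (simp add: alternating_summand_def qbinom_eq_0)
next
  case False
  then have "N + x b \<noteq> -1 \<or> M - b \<noteq> 0"
    using assms(1) by linarith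
  then have "qbinom (N + x b + 1) (M - b) = qbinom (N + x b) (M - b) +
      q powi (N + x b + 1 - (M - b)) * qbinom (N + x b) (M - (b + 1))"
    using qbinom_pascal_right[of "N + x b" "M - b"] by (simp add: algebra_simps)
  moreover have "q powi (g (b + 1) + (N + 1 - x (b + 1) - M - (b + 1))) =
      q powi g b * q powi (N + x b + 1 - (M - b))"
    unfolding assms(2,3) q_powi_add[symmetric] by (simp add: algebra_simps)
  moreover have "(-1) powi (b + 1) = - ((-1) powi b :: 'a)"
    by (simp add: power_int_minus_left)
  ultimately show ?thesis
    unfolding alternating_summand_def assms(2) by (simp add: algebra_simps)
qed

lemma alternating_sum_raise_upper:
  assumes x: "\<And>b. odd b \<Longrightarrow> x (b + 1) = x b"
    and g: "\<And>b. odd b \<Longrightarrow> g (b + 1) = g b + 2 * x b + 2 * b + 1"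
    and x_nonneg: "\<And>b. 0 \<le> b \<Longrightarrow> 0 \<le> N + x b" and x_le: "\<And>b. b < 0 \<Longrightarrow> x b \<le> N"
  shows "alternating_sum g (\<lambda>b. x b + (even_ceil b - b)) 2 1 N M = alternating_sum g x 1 1 N M"
proof -
  let ?raised = "alternating_summand g (\<lambda>b. x b + (even_ceil b - b)) 2 1 N M"
  let ?original = "alternating_summand g x 1 1 N M"
  define surplus where
    "surplus = alternating_summand (\<lambda>b. g b + (N + 1 - x b - M - b)) x 1 0 N M"
  have difference: "?raised b - ?original b = (if even b then surplus b else - surplus (b + 1))"
    for b
  proof (cases "even b")
    case True
    then have "?raised b = alternating_summand g x 2 1 N M b"
      by (simp add: alternating_summand_def even_ceil_def)
    with True show ?thesis
      by (simp add: surplus_def alternating_summand_raise_right[of b x N, OF x_le])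
  next
    case False
    then have "?raised b = alternating_summand g (\<lambda>b. x b + 1) 2 1 N M b"
      by (simp add: alternating_summand_def even_ceil_def)
    also have "\<dots> = ?original b - surplus (b + 1)"
      unfolding surplus_def
      by (rule alternating_summand_raise_left) (use False x g x_nonneg in auto)
    finally show ?thesis
      using False by simp
  qed
  have "Sum_any ?raised - Sum_any ?original = (\<Sum>b. if even b then surplus b else - surplus (b + 1))"
    unfolding difference[symmetric]
    by (rule Sum_any_diff[symmetric]) (rule finite_alternating_summand)+
  also have "\<dots> = 0"
    by (rule Sum_any_involution_eq_0[of "\<lambda>b. if even b then b - 1 else b + 1"]) auto
  finally show ?thesis
    by (simp add: alternating_sum_def)
qed

lemma sum_weighted_alternating_sum:
  "(\<Sum>m\<in>A. q powi (m\<^sup>2 + e * m) * w m * alternating_sum g x d e N m) =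
    (\<Sum>b. (-1) powi b * q powi (g b + b\<^sup>2 + e * b) *
      (\<Sum>m\<in>A. q powi ((m - b) * (m + (b + e))) *
        (w m * qbinom (N + x b) (m - b) * qbinom (N + d - x b) (m + (b + e)))))"
proof -
  have "q powi (m\<^sup>2 + e * m) * w m * alternating_summand g x d e N m b =
      (-1) powi b * q powi (g b + b\<^sup>2 + e * b) * (q powi ((m - b) * (m + (b + e))) *
        (w m * qbinom (N + x b) (m - b) * qbinom (N + d - x b) (m + (b + e))))" for m b
  proof -
    have "q powi (m\<^sup>2 + e * m) * q powi g b =
        q powi (g b + b\<^sup>2 + e * b) * q powi ((m - b) * (m + (b + e)))"
      unfolding q_powi_add[symmetric] by (simp add: algebra_simps power2_eq_square)
    then show ?thesis
      unfolding alternating_summand_def add.assoc[of m b e] by algebra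
  qed
  moreover have "(\<Sum>m\<in>A. q powi (m\<^sup>2 + e * m) * w m * alternating_sum g x d e N m) =
      (\<Sum>b. \<Sum>m\<in>A. q powi (m\<^sup>2 + e * m) * w m * alternating_summand g x d e N m b)"
    unfolding alternating_sum_def Sum_any_mult_left
    by (rule sum_Sum_any_swap, rule finite_subset[OF _ finite_alternating_summand]) auto
  ultimately show ?thesis
    by (simp only: sum_distrib_left)
qed

lemma sum_alternating_sum_saalschuetz:
  assumes e: "e \<in> {0, 1}"
    and x_nonneg: "\<And>b. 0 \<le> b \<Longrightarrow> 0 \<le> N + x b" and x_le: "\<And>b. b < 0 \<Longrightarrow> x b \<le> N + d"
  shows "(\<Sum>m=0..M. q powi (m\<^sup>2 + e * m) * qbinom (2 * N + d + M - m) (M - m) *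
      alternating_sum g x d e N m) =
    alternating_sum (\<lambda>b. g b + b\<^sup>2 + e * b) (\<lambda>b. x b + b) (d - e) e (N + M + e) M"
proof -
  have inner: "(\<Sum>m=0..M. q powi ((m - b) * (m + (b + e))) * (qbinom (2 * N + d + M - m) (M - m) *
        qbinom (N + x b) (m - b) * qbinom (N + d - x b) (m + (b + e)))) =
      qbinom (N + M + e + (x b + b)) (M - b) * qbinom (N + M + e + (d - e) - (x b + b)) (M + b + e)"
    (is "sum ?f _ = _") for b
  proof -
    have "{m. ?f m \<noteq> 0} \<subseteq> {0..M}"
      using e by (auto dest!: q_binomial_nonzeroD)
    then have "sum ?f {0..M} = Sum_any ?f"
      by (intro Sum_any.expand_superset[symmetric]) auto
    also have "\<dots> = qbinom (N + x b + M + (b + e)) (M - b) *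
        qbinom (N + d - x b + M - b) (M + (b + e))"
    proof -
      have "0 \<le> N + x b \<or> b + (b + e) \<le> 0" "0 \<le> N + d - x b \<or> 0 \<le> b + (b + e)"
        using e x_nonneg[of b] x_le[of b] by auto
      from q_saalschuetz[OF this, of M] show ?thesis by simp
    qed
    finally show ?thesis by (simp add: algebra_simps)
  qed
  show ?thesis
    unfolding sum_weighted_alternating_sum inner
    by (simp add: alternating_sum_def alternating_summand_def)
qed

lemma sum_alternating_sum_vandermonde:
  assumes e: "e \<in> {0, 1}"
    and x_nonneg: "\<And>b. 0 \<le> b \<Longrightarrow> 0 \<le> N + x b" and x_le: "\<And>b. b < 0 \<Longrightarrow> x b \<le> N + d"
    and B: "2 * N + d - e \<le> 2 * B + 1"
  shows "(\<Sum>m=0..B. q powi (m\<^sup>2 + e * m) * alternating_sum g x d e N m) =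
    (\<Sum>b. (-1) powi b * q powi (g b + b\<^sup>2 + e * b) * qbinom (2 * N + d) (N + d - x b - 2 * b - e))"
proof -
  have inner: "(\<Sum>m=0..B. q powi ((m - b) * (m + (b + e))) *
        (1 * qbinom (N + x b) (m - b) * qbinom (N + d - x b) (m + (b + e)))) =
      qbinom (2 * N + d) (N + d - x b - 2 * b - e)" (is "sum ?f _ = _") for b
  proof -
    have "{m. ?f m \<noteq> 0} \<subseteq> {0..B}"
      using e B by (auto dest!: q_binomial_nonzeroD)
    then have "sum ?f {0..B} = Sum_any ?f"
      by (intro Sum_any.expand_superset[symmetric]) auto
    also have "\<dots> = qbinom (N + x b + (N + d - x b)) (N + d - x b - b - (b + e))"
    proof (simp only: mult_1_left, rule q_vandermonde_centred)
      show "0 \<le> N + x b \<or> b + (b + e) \<le> 0" "0 \<le> N + d - x b \<or> 0 \<le> b + (b + e)"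
        using e x_nonneg[of b] x_le[of b] by auto
    qed
    finally show ?thesis by (simp add: algebra_simps)
  qed
  show ?thesis
    using sum_weighted_alternating_sum[of e "\<lambda>_. 1" g x d N "{0..B}"] unfolding inner by simp
qed

text \<open>
  The value of a multisum like the one in question, with \<open>t\<close> summation variables of weight
  \<open>q powi m\<^sup>2\<close> followed by \<open>s\<close> of weight \<open>q powi (m\<^sup>2 + m)\<close>.
\<close>

definition bosonic_sum :: "int \<Rightarrow> int \<Rightarrow> int \<Rightarrow> int \<Rightarrow> 'a" where
  "bosonic_sum s t = alternating_sum (bosonic_exponent s t) (upper_shift s t) 0 0"

lemma bosonic_sum_raise_lower:
  assumes "e \<in> {0, 1}" "e = 1 \<Longrightarrow> t = 0" "0 \<le> N" "0 \<le> s"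
  shows "alternating_sum (bosonic_exponent s t) (upper_shift s t) e e N M = bosonic_sum s t N M"
proof (cases "e = 0")
  case True
  then show ?thesis by (simp add: bosonic_sum_def)
next
  case False
  then have "e = 1" "t = 0" using assms by auto
  moreover have "alternating_sum (bosonic_exponent s 0) (upper_shift s 0) 1 1 N M =
      alternating_sum (bosonic_exponent s 0) (upper_shift s 0) 0 0 N M"
  proof (rule alternating_sum_raise_lower)
    show "upper_shift s 0 b \<le> N" if "b < 0" for b
      using upper_shift_nonpos[of s 0 b] that assms by simp
  qed (simp_all add: upper_shift_def even_ceil_reflect bosonic_exponent_reflect)
  ultimately show ?thesis by (simp add: bosonic_sum_def)
qed

lemma bosonic_sum_raise_upper:
  assumes "e \<in> {0, 1}" "e = 1 \<Longrightarrow> t = 0" "0 \<le> N" "0 \<le> s"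
  shows "alternating_sum (bosonic_exponent s t) (upper_shift (s + e) (t - e)) (2 * e) e N M =
    bosonic_sum s t N M"
proof (cases "e = 0")
  case True
  then show ?thesis by (simp add: bosonic_sum_def)
next
  case False
  then have "e = 1" "t = 0" using assms by auto
  have "alternating_sum (bosonic_exponent s 0) (\<lambda>b. upper_shift s 0 b + (even_ceil b - b)) 2 1 N M =
      alternating_sum (bosonic_exponent s 0) (upper_shift s 0) 1 1 N M"
  proof (rule alternating_sum_raise_upper)
    show "0 \<le> N + upper_shift s 0 b" if "0 \<le> b" for b
      using upper_shift_nonneg[of s 0 b] that assms by simp
    show "upper_shift s 0 b \<le> N" if "b < 0" for b
      using upper_shift_nonpos[of s 0 b] that assms by simp
  qed (simp_all add: bosonic_exponent_def upper_shift_def even_ceil_def algebra_simps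
      power2_eq_square)
  moreover have "(\<lambda>b. upper_shift s 0 b + (even_ceil b - b)) = upper_shift (s + 1) (0 - 1)"
    by (simp add: upper_shift_def fun_eq_iff algebra_simps)
  ultimately show ?thesis
    using bosonic_sum_raise_lower[OF assms] \<open>e = 1\<close> \<open>t = 0\<close> by simp
qed

lemma bosonic_sum_step:
  assumes "e \<in> {0, 1}" "e = 1 \<Longrightarrow> t = 0" "e \<le> L" "0 \<le> M" "0 \<le> s" "0 \<le> t"
  shows "(\<Sum>m=0..M. q powi (m\<^sup>2 + e * m) * qbinom (2 * L + M - m) (M - m) *
      bosonic_sum s t (L - e) m) = bosonic_sum (s + e) (t + 1 - e) (L + M) M"
proof -
  have "(\<Sum>m=0..M. q powi (m\<^sup>2 + e * m) * qbinom (2 * L + M - m) (M - m) *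
        bosonic_sum s t (L - e) m) =
      (\<Sum>m=0..M. q powi (m\<^sup>2 + e * m) * qbinom (2 * (L - e) + 2 * e + M - m) (M - m) *
        alternating_sum (bosonic_exponent s t) (upper_shift (s + e) (t - e)) (2 * e) e (L - e) m)"
    using assms by (simp add: bosonic_sum_raise_upper)
  also have "\<dots> = alternating_sum (\<lambda>b. bosonic_exponent s t b + b\<^sup>2 + e * b)
      (\<lambda>b. upper_shift (s + e) (t - e) b + b) (2 * e - e) e (L - e + M + e) M"
    by (rule sum_alternating_sum_saalschuetz)
      (use assms raised_upper_shift_bounds[of e "L - e" s t] in auto)
  also have "\<dots> = alternating_sum (bosonic_exponent (s + e) (t + 1 - e))
      (upper_shift (s + e) (t + 1 - e)) e e (L + M) M"
    unfolding bosonic_exponent_step by (simp add: upper_shift_def[abs_def] algebra_simps)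
  also have "\<dots> = bosonic_sum (s + e) (t + 1 - e) (L + M) M"
    by (rule bosonic_sum_raise_lower) (use assms in auto)
  finally show ?thesis .
qed

lemma sum_bosonic_sum:
  assumes "e \<in> {0, 1}" "e = 1 \<Longrightarrow> t = 0" "e \<le> n" "n \<le> B" "0 \<le> s" "0 \<le> t"
  shows "(\<Sum>m=0..B. q powi (m\<^sup>2 + e * m) * bosonic_sum s t (n - e) m) =
    (\<Sum>b. (-1) powi b * q powi bosonic_exponent (s + e) (t + 1 - e) b *
      qbinom (2 * n) (n - upper_shift (s + e) (t + 2 - e) b))"
proof -
  have "(\<Sum>m=0..B. q powi (m\<^sup>2 + e * m) * bosonic_sum s t (n - e) m) =
      (\<Sum>m=0..B. q powi (m\<^sup>2 + e * m) *
        alternating_sum (bosonic_exponent s t) (upper_shift (s + e) (t - e)) (2 * e) e (n - e) m)"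
    using assms by (simp add: bosonic_sum_raise_upper)
  also have "\<dots> = (\<Sum>b. (-1) powi b * q powi (bosonic_exponent s t b + b\<^sup>2 + e * b) *
      qbinom (2 * (n - e) + 2 * e) (n - e + 2 * e - upper_shift (s + e) (t - e) b - 2 * b - e))"
    by (rule sum_alternating_sum_vandermonde)
      (use assms raised_upper_shift_bounds[of e "n - e" s t] in auto)
  also have "\<dots> = (\<Sum>b. (-1) powi b * q powi bosonic_exponent (s + e) (t + 1 - e) b *
      qbinom (2 * n) (n - upper_shift (s + e) (t + 2 - e) b))"
    unfolding bosonic_exponent_step by (simp add: upper_shift_def algebra_simps)
  finally show ?thesis .
qed

lemma bosonic_sum_0_0: "bosonic_sum 0 0 = alternating_sum (\<lambda>b. b\<^sup>2) (\<lambda>_. 0) 0 0"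
proof -
  have "bosonic_exponent 0 0 = (\<lambda>b. b\<^sup>2)" "upper_shift 0 0 = (\<lambda>_. 0)"
    by (simp_all add: bosonic_exponent_def upper_shift_def fun_eq_iff)
  then show ?thesis
    by (simp add: bosonic_sum_def)
qed

lemma alternating_summand_square_Suc:
  assumes "0 \<le> N"
  shows "alternating_summand (\<lambda>b. b\<^sup>2) (\<lambda>_. 0) 0 0 (N + 1) M b =
    alternating_summand (\<lambda>b. b\<^sup>2) (\<lambda>_. 0) 1 1 N (M - 1) b +
    (q powi M * alternating_summand (\<lambda>b. b\<^sup>2 - b) (\<lambda>_. 0) 0 (-1) N M b +
     q powi (2 * M) * alternating_summand (\<lambda>b. b\<^sup>2) (\<lambda>_. 0) 0 0 N M b)"
proof -
  have left: "qbinom (N + 1) (M - b) = qbinom N (M - 1 - b) + q powi (M - b) * qbinom N (M - b)"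
    using qbinom_pascal_left[of N "M - b"] assms by (simp add: algebra_simps)
  have right: "qbinom (N + 1) (M + b) = qbinom N (M + b - 1) + q powi (M + b) * qbinom N (M + b)"
    using qbinom_pascal_left[of N "M + b"] assms by simp
  have powers: "q powi M * q powi (b\<^sup>2 - b) = q powi b\<^sup>2 * q powi (M - b)"
    "q powi (2 * M) = q powi (M - b) * q powi (M + b)"
    unfolding q_powi_add[symmetric] by (simp_all add: algebra_simps)
  have "qbinom (N + 1) (M - b) * qbinom (N + 1) (M + b) =
      qbinom N (M - 1 - b) * qbinom (N + 1) (M + b) +
      q powi (M - b) * qbinom N (M - b) *
        (qbinom N (M + b - 1) + q powi (M + b) * qbinom N (M + b))"
    unfolding left right[symmetric] by (rule distrib_right)
  then show ?thesis
    using powers by (simp add: alternating_summand_def) algebra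
qed

lemma bosonic_sum_0_0_Suc:
  assumes "0 \<le> N"
  shows "bosonic_sum 0 0 (N + 1) M =
    bosonic_sum 0 0 N (M - 1) + q powi (2 * M) * bosonic_sum 0 0 N M"
proof -
  let ?A = "alternating_summand (\<lambda>b. b\<^sup>2) (\<lambda>_. 0) 1 1 N (M - 1)"
  let ?B = "alternating_summand (\<lambda>b. b\<^sup>2 - b) (\<lambda>_. 0) 0 (-1) N M"
  let ?C = "alternating_summand (\<lambda>b. b\<^sup>2) (\<lambda>_. 0) 0 0 N M"
  have finite: "finite {b. q powi M * ?B b \<noteq> 0}" "finite {b. q powi (2 * M) * ?C b \<noteq> 0}"
    using q_nonzero finite_alternating_summand by simp_all
  then have "finite {b. q powi M * ?B b + q powi (2 * M) * ?C b \<noteq> 0}"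
    by (rule finite_subset[rotated, OF finite_UnI]) auto
  with finite have "bosonic_sum 0 0 (N + 1) M =
      Sum_any ?A + (q powi M * Sum_any ?B + q powi (2 * M) * Sum_any ?C)"
    unfolding bosonic_sum_0_0 alternating_sum_def alternating_summand_square_Suc[OF assms]
    by (simp only: Sum_any.distrib Sum_any_mult_left finite_alternating_summand)
  also have "Sum_any ?B = 0"
    using alternating_sum_odd_eq_0[of "-1" "\<lambda>b. b\<^sup>2 - b" "\<lambda>_. 0" N M]
    by (simp add: alternating_sum_def algebra_simps power2_eq_square)
  also have "Sum_any ?A = alternating_sum (\<lambda>b. b\<^sup>2) (\<lambda>_. 0) 0 0 N (M - 1)"
    unfolding alternating_sum_def[symmetric]
    by (rule alternating_sum_raise_lower) (use assms in \<open>auto simp: algebra_simps power2_eq_square\<close>)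
  finally show ?thesis
    by (simp add: bosonic_sum_0_0 alternating_sum_def)
qed

lemma generic_base_square: "generic_base (q\<^sup>2)"
  by unfold_locales (use q_nonzero not_root_of_unity in \<open>auto simp: power_mult[symmetric]\<close>)

lemma bosonic_sum_0_0_eq_q_binomial:
  assumes "0 \<le> N"
  shows "bosonic_sum 0 0 N M = q_binomial (q\<^sup>2) N M"
  using assms
proof (induction N arbitrary: M rule: int_ge_induct)
  case base
  interpret square: generic_base "q\<^sup>2" by (rule generic_base_square)
  have "bosonic_sum 0 0 0 M = (\<Sum>b::int. if b = 0 then q_binomial (q\<^sup>2) 0 M else 0)"
    unfolding bosonic_sum_0_0 alternating_sum_def
    by (rule Sum_any.cong)
      (auto simp: alternating_summand_def qbinom_0_left square.qbinom_0_left)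
  then show ?case by simp
next
  case (step N)
  interpret square: generic_base "q\<^sup>2" by (rule generic_base_square)
  have "q powi (2 * M) = (q\<^sup>2) powi M"
    by (simp add: power_int_mult)
  then show ?case
    using square.qbinom_pascal_left[of N M] step by (simp add: bosonic_sum_0_0_Suc)
qed

abbreviation qbinom' :: "int \<Rightarrow> int \<Rightarrow> 'a" where
  "qbinom' \<equiv> q_binomial' q"

lemma qbinom'_nonneg: "0 \<le> a \<Longrightarrow> qbinom' a b = qbinom a b"
  by (simp add: q_binomial'_def)

lemma qbinom'_double: "L < 0 \<Longrightarrow> 0 \<le> M \<Longrightarrow> qbinom' (2 * L + M) M = (if M = 0 then 1 else 0)"
  by (auto simp: q_binomial'_def qbinom_eq_0)

lemma bosonic_sum_eq_0:
  assumes "N < M"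
  shows "bosonic_sum s t N M = 0"
proof -
  have "alternating_summand g (upper_shift s t) 0 0 N M b = 0" for g b
    using assms by (cases "M - b \<le> N + upper_shift s t b")
      (auto simp: alternating_summand_def qbinom_eq_0)
  then show ?thesis
    by (simp add: bosonic_sum_def alternating_sum_def)
qed

lemma bosonic_sum_diagonal:
  assumes "0 \<le> M" "0 \<le> s" "0 \<le> t"
  shows "bosonic_sum s t M M = 1"
proof -
  have "qbinom (M + upper_shift s t b) (M - b) * qbinom (M - upper_shift s t b) (M + b) = 0"
    if "b \<noteq> 0" for b
  proof (cases "0 < b")
    case True
    then show ?thesis using upper_shift_nonneg[OF assms(2,3), of b] by (simp add: qbinom_eq_0)
  next
    case False
    then show ?thesis using upper_shift_nonpos[OF assms(2,3), of b] that by (simp add: qbinom_eq_0)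
  qed
  then have "bosonic_sum s t M M = (\<Sum>b::int. if b = 0 then 1 else 0)"
    unfolding bosonic_sum_def alternating_sum_def using assms(1)
    by (intro Sum_any.cong)
      (auto simp: alternating_summand_def bosonic_exponent_def upper_shift_def even_ceil_def)
  then show ?thesis by simp
qed

text \<open>
  The convention of \<^const>\<open>q_binomial'\<close> carried over to \<open>bosonic_sum\<close>, with \<open>L = N - M\<close>.
\<close>

definition bosonic_sum' :: "int \<Rightarrow> int \<Rightarrow> int \<Rightarrow> int \<Rightarrow> 'a" where
  "bosonic_sum' s t L M = (if L < 0 \<and> M = 0 then 1 else bosonic_sum s t (L + M) M)"

lemma bosonic_sum'_negative:
  "L < 0 \<Longrightarrow> 0 \<le> M \<Longrightarrow> bosonic_sum' s t L M = (if M = 0 then 1 else 0)"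
  by (simp add: bosonic_sum'_def bosonic_sum_eq_0)

lemma bosonic_sum'_diff: "0 \<le> N \<Longrightarrow> bosonic_sum' s t (N - M) M = bosonic_sum s t N M"
  by (auto simp: bosonic_sum'_def)

lemma bosonic_sum'_0_0: "0 \<le> M \<Longrightarrow> bosonic_sum' 0 0 L M = q_binomial' (q\<^sup>2) (L + M) M"
  by (cases "0 \<le> L + M")
    (auto simp: bosonic_sum'_def q_binomial'_def bosonic_sum_0_0_eq_q_binomial bosonic_sum_eq_0
      q_binomial_def)

lemma bosonic_sum'_step:
  assumes "e \<in> {0, 1}" "e = 1 \<Longrightarrow> t = 0" "0 \<le> M" "0 \<le> s" "0 \<le> t"
  shows "(\<Sum>m=0..M. q powi (m\<^sup>2 + e * m) * qbinom' (2 * L + M - m) (M - m) *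
      bosonic_sum' s t (L - e - m) m) = bosonic_sum' (s + e) (t + 1 - e) L M"
proof (cases "0 \<le> L - e")
  case True
  have "(\<Sum>m=0..M. q powi (m\<^sup>2 + e * m) * qbinom' (2 * L + M - m) (M - m) *
        bosonic_sum' s t (L - e - m) m) =
      (\<Sum>m=0..M. q powi (m\<^sup>2 + e * m) * qbinom (2 * L + M - m) (M - m) * bosonic_sum s t (L - e) m)"
    using True assms by (intro sum.cong refl) (auto simp: bosonic_sum'_diff qbinom'_nonneg)
  also have "\<dots> = bosonic_sum (s + e) (t + 1 - e) (L + M) M"
    by (rule bosonic_sum_step) (use True assms in auto)
  finally show ?thesis
    using True assms by (auto simp: bosonic_sum'_def)
next
  case False
  have "(\<Sum>m=0..M. q powi (m\<^sup>2 + e * m) * qbinom' (2 * L + M - m) (M - m) *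
        bosonic_sum' s t (L - e - m) m) = (\<Sum>m=0..M. if m = 0 then qbinom' (2 * L + M) M else 0)"
    using False by (intro sum.cong refl) (auto simp: bosonic_sum'_negative)
  also have "\<dots> = qbinom' (2 * L + M) M"
    using assms(3) by simp
  also have "\<dots> = bosonic_sum' (s + e) (t + 1 - e) L M"
  proof (cases "L = 0")
    case True
    have "0 \<le> s + e" "0 \<le> t + 1 - e"
      using assms by auto
    then show ?thesis
      using True assms(3) by (simp add: qbinom'_nonneg bosonic_sum'_def bosonic_sum_diagonal)
  next
    case nonzero: False
    then have "L < 0"
      using False assms(1) by auto
    then show ?thesis
      using assms(3) by (simp add: qbinom'_double bosonic_sum'_negative)
  qed
  finally show ?thesis .
qed

lemma sum_bosonic_sum':
  assumes "e \<in> {0, 1}" "e = 1 \<Longrightarrow> t = 0" "0 \<le> n" "n \<le> B" "0 \<le> s" "0 \<le> t"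
  shows "(\<Sum>m=0..B. q powi (m\<^sup>2 + e * m) * bosonic_sum' s t (n - e - m) m) =
    (\<Sum>b. (-1) powi b * q powi bosonic_exponent (s + e) (t + 1 - e) b *
      qbinom (2 * n) (n - upper_shift (s + e) (t + 2 - e) b))"
proof (cases "e \<le> n")
  case True
  have "(\<Sum>m=0..B. q powi (m\<^sup>2 + e * m) * bosonic_sum' s t (n - e - m) m) =
      (\<Sum>m=0..B. q powi (m\<^sup>2 + e * m) * bosonic_sum s t (n - e) m)"
    using True by (simp add: bosonic_sum'_diff)
  also have "\<dots> = (\<Sum>b. (-1) powi b * q powi bosonic_exponent (s + e) (t + 1 - e) b *
      qbinom (2 * n) (n - upper_shift (s + e) (t + 2 - e) b))"
    by (rule sum_bosonic_sum) (use True assms in auto)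
  finally show ?thesis .
next
  case False
  then have e: "e = 1" and n: "n = 0" and t: "t = 0"
    using assms by auto
  have "(\<Sum>m=0..B. q powi (m\<^sup>2 + e * m) * bosonic_sum' s t (n - e - m) m) =
      (\<Sum>m=0..B. if m = 0 then 1 else 0)"
    by (intro sum.cong refl) (auto simp: e n bosonic_sum'_negative)
  moreover have "(\<Sum>b. (-1) powi b * q powi bosonic_exponent (s + e) (t + 1 - e) b *
      qbinom (2 * n) (n - upper_shift (s + e) (t + 2 - e) b)) = (\<Sum>b::int. if b = 0 then 1 else 0)"
    by (intro Sum_any.cong)
      (use assms(5) in \<open>simp add: e n t qbinom_0_left bosonic_exponent_def upper_shift_eq_0_iff\<close>)
  ultimately show ?thesis
    using assms(4) n by simp
qed

end

section \<open>Multisums over decreasing tuples\<close>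

definition bounded_tuples :: "int \<Rightarrow> int \<Rightarrow> (int \<Rightarrow> int) set" where
  "bounded_tuples B l = {m \<in> decreasing_tuples l. m 1 \<le> B}"

lemma bounded_tuples_iff:
  assumes "1 \<le> l"
  shows "m \<in> bounded_tuples B l \<longleftrightarrow> m 1 \<le> B \<and> (\<forall>j. j < 1 \<or> l < j \<longrightarrow> m j = undefined) \<and>
    (\<forall>j. 1 \<le> j \<and> j \<le> l \<longrightarrow> 0 \<le> m j) \<and> (\<forall>j j'. 1 \<le> j \<and> j \<le> j' \<and> j' \<le> l \<longrightarrow> m j' \<le> m j)"
  using assms
  by (auto simp: bounded_tuples_def decreasing_tuples_def PiE_iff extensional_def monotone_on_def
      not_le)

lemma bounded_tuples_nonneg: "m \<in> bounded_tuples B l \<Longrightarrow> 1 \<le> j \<Longrightarrow> j \<le> l \<Longrightarrow> 0 \<le> m j"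
  by (auto simp: bounded_tuples_def decreasing_tuples_def PiE_iff)

lemma finite_bounded_tuples:
  assumes "1 \<le> l"
  shows "finite (bounded_tuples B l)"
proof (rule finite_subset)
  show "bounded_tuples B l \<subseteq> {1..l} \<rightarrow>\<^sub>E {0..B}"
  proof
    fix m assume "m \<in> bounded_tuples B l"
    then show "m \<in> {1..l} \<rightarrow>\<^sub>E {0..B}"
      unfolding bounded_tuples_iff[OF assms]
      by (auto simp: PiE_iff extensional_def not_le intro: order_trans[of _ "m 1"])
  qed
qed (intro finite_PiE; simp)

lemma sum_bounded_tuples_1:
  "sum f (bounded_tuples B 1) = (\<Sum>v=0..B. f ((\<lambda>_. undefined)(1 := v)))"
proof (rule sum.reindex_bij_witness[of _ "\<lambda>v. (\<lambda>_. undefined)(1 := v)" "\<lambda>m. m 1"])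
  fix m assume m: "m \<in> bounded_tuples B 1"
  then show eq: "(\<lambda>_. undefined)(1 := m 1) = m"
    by (auto simp: bounded_tuples_iff fun_eq_iff linorder_neq_iff)
  show "m 1 \<in> {0..B}"
    using m by (auto simp: bounded_tuples_iff)
  show "f ((\<lambda>_. undefined)(1 := m 1)) = f m"
    by (simp add: eq)
qed (auto simp: bounded_tuples_iff)

lemma sum_bounded_tuples_Suc:
  assumes "1 \<le> l"
  shows "sum f (bounded_tuples B (l + 1)) =
    (\<Sum>m\<in>bounded_tuples B l. \<Sum>v=0..m l. f (m(l + 1 := v)))"
proof -
  have l: "1 \<le> l + 1" using assms by simp
  let ?split = "\<lambda>m. (m(l + 1 := undefined), m (l + 1))" and ?join = "\<lambda>(m, v). m(l + 1 := v)"
  have "(\<Sum>m\<in>bounded_tuples B l. \<Sum>v=0..m l. f (m(l + 1 := v))) =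
      (\<Sum>(m, v)\<in>(SIGMA m:bounded_tuples B l. {0..m l}). f (m(l + 1 := v)))"
    by (rule sum.Sigma) (use finite_bounded_tuples[OF assms] in auto)
  also have "\<dots> = sum f (bounded_tuples B (l + 1))"
  proof (rule sum.reindex_bij_witness[of _ ?split ?join])
    fix p assume "p \<in> (SIGMA m:bounded_tuples B l. {0..m l})"
    then obtain m v where p: "p = (m, v)" and m: "m \<in> bounded_tuples B l" and v: "0 \<le> v" "v \<le> m l"
      by auto
    have "m (l + 1) = undefined"
      using m by (simp add: bounded_tuples_iff[OF assms])
    then show "?split (?join p) = p"
      by (auto simp: p fun_upd_idem)
    have "v \<le> m j" if "1 \<le> j" "j \<le> l" for j
      using m v that unfolding bounded_tuples_iff[OF assms] by (meson order.refl order.trans)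
    then show "?join p \<in> bounded_tuples B (l + 1)"
      using m v assms unfolding bounded_tuples_iff[OF assms] bounded_tuples_iff[OF l] p by auto
  next
    fix m assume "m \<in> bounded_tuples B (l + 1)"
    then show "?split m \<in> (SIGMA m:bounded_tuples B l. {0..m l})"
      using assms unfolding bounded_tuples_iff[OF l] by (auto simp: bounded_tuples_iff[OF assms])
  qed auto
  finally show ?thesis ..
qed

lemma Sum_any_eq_sum_bounded_tuples:
  assumes l: "1 \<le> l" and "finite {m. f m \<noteq> 0}" and "{m. f m \<noteq> 0} \<subseteq> decreasing_tuples l"
  obtains B where "n \<le> B" "Sum_any f = sum f (bounded_tuples B l)"
proof
  let ?S = "{m. f m \<noteq> 0}"
  define B where "B = Max (insert n ((\<lambda>m. m 1) ` ?S))"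
  show "n \<le> B"
    using assms(2) by (simp add: B_def)
  have "m 1 \<le> B" if "m \<in> ?S" for m
    unfolding B_def by (rule Max_ge) (use assms(2) that in auto)
  then show "Sum_any f = sum f (bounded_tuples B l)"
    using assms(3) by (intro Sum_any.expand_superset finite_bounded_tuples[OF l])
      (auto simp: bounded_tuples_def)
qed

lemma atLeastAtMost_insert_right_int: "a \<le> b + 1 \<Longrightarrow> {a..b + 1} = insert (b + 1) {a..b}" for b :: int
  by auto

definition linking_factor :: "'a::field \<Rightarrow> int \<Rightarrow> int \<Rightarrow> (int \<Rightarrow> int) \<Rightarrow> int \<Rightarrow> 'a" where
  "linking_factor q n i m j = q_binomial' q
     (2 * n - 2 * (\<Sum>l=1..j-1. m l) - m j - m (j + 1) - 2 * alpha i j) (m j - m (j + 1))"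

definition prefix_product :: "'a::field \<Rightarrow> int \<Rightarrow> int \<Rightarrow> int \<Rightarrow> (int \<Rightarrow> int) \<Rightarrow> 'a" where
  "prefix_product q n i j m =
     q powi ((\<Sum>l=1..j. (m l)\<^sup>2) + (\<Sum>l=i..j. m l)) * (\<Prod>l=1..j-1. linking_factor q n i m l)"

definition fermionic_summand :: "'a::field \<Rightarrow> int \<Rightarrow> int \<Rightarrow> int \<Rightarrow> (int \<Rightarrow> int) \<Rightarrow> 'a" where
  "fermionic_summand q n k i = (\<lambda>m.
     if m \<in> decreasing_tuples (k - 1) then
       q powi ((\<Sum>j=1..k-1. (m j)\<^sup>2) + (\<Sum>j=i..k-1. m j)) *
       q_binomial' (q\<^sup>2) (n - (\<Sum>j=1..k-2. m j) - k + i) (m (k - 1)) *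
       (\<Prod>j=1..k-2. q_binomial' q
          (2 * n - 2 * (\<Sum>l=1..j-1. m l) - m j - m (j + 1) - 2 * alpha i j)
          (m j - m (j + 1)))
     else 0)"

definition bosonic_summand :: "'a::field \<Rightarrow> int \<Rightarrow> int \<Rightarrow> int \<Rightarrow> int \<Rightarrow> 'a" where
  "bosonic_summand q n k i = (\<lambda>r.
     (-1) powi r * q powi (r * (k * r + k - i)) *
     q_binomial q (2 * n) (n - k * r + (k - i) * (((-1) ^ nat \<bar>r\<bar> - 1) div 2)))"

lemma fermionic_summand_eq:
  "m \<in> decreasing_tuples (k - 1) \<Longrightarrow> fermionic_summand q n k i m = prefix_product q n i (k - 1) m *
    q_binomial' (q\<^sup>2) (n - (\<Sum>j=1..k-2. m j) - k + i) (m (k - 1))"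
  by (simp add: fermionic_summand_def prefix_product_def linking_factor_def mult_ac)

lemma finite_fermionic_summand:
  assumes "0 \<le> n" "2 \<le> k" "i \<le> k"
  shows "finite {m. fermionic_summand q n k i m \<noteq> 0}"
  by (rule finite_subset[OF _ finite_support_left[OF assms, of q]])
    (auto simp: fermionic_summand_def)

lemma prefix_product_cong:
  assumes "\<And>l. l \<le> j \<Longrightarrow> m l = m' l"
  shows "prefix_product q n i j m = prefix_product q n i j m'"
proof -
  have "linking_factor q n i m l = linking_factor q n i m' l" if "l \<le> j - 1" for l
  proof -
    have "(\<Sum>r=1..l-1. m r) = (\<Sum>r=1..l-1. m' r)"
      by (rule sum.cong) (use assms that in auto)
    with assms that show ?thesis by (simp add: linking_factor_def)
  qed
  with assms show ?thesis by (simp add: prefix_product_def)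
qed

context generic_base
begin

lemma prefix_product_Suc:
  assumes "1 \<le> j"
  shows "prefix_product q n i (j + 1) m = prefix_product q n i j m *
    (q powi ((m (j + 1))\<^sup>2 + of_bool (i \<le> j + 1) * m (j + 1)) *
     qbinom' (2 * (n - (\<Sum>l=1..j. m l) - alpha i j) + m j - m (j + 1)) (m j - m (j + 1)))"
proof -
  have interval: "{1..j} = insert j {1..j-1}"
    using assms by auto
  have "linking_factor q n i m j =
      qbinom' (2 * (n - (\<Sum>l=1..j. m l) - alpha i j) + m j - m (j + 1)) (m j - m (j + 1))"
    by (simp add: linking_factor_def interval algebra_simps)
  moreover have "(\<Prod>l=1..j. linking_factor q n i m l) =
      linking_factor q n i m j * (\<Prod>l=1..j-1. linking_factor q n i m l)"
    by (simp add: interval)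
  moreover have "(\<Sum>l=1..j+1. (m l)\<^sup>2) + (\<Sum>l=i..j+1. m l) =
      ((\<Sum>l=1..j. (m l)\<^sup>2) + (\<Sum>l=i..j. m l)) + ((m (j + 1))\<^sup>2 + of_bool (i \<le> j + 1) * m (j + 1))"
    using assms by (simp add: atLeastAtMost_insert_right_int)
  ultimately show ?thesis
    by (simp add: prefix_product_def q_powi_add[of "_ + _" "_ + _"])
qed

text \<open>
  The multisum after summation over \<open>n\<^sub>j\<^sub>+\<^sub>1, \<dots>, n\<^sub>k\<^sub>-\<^sub>1\<close>: of these variables
  \<open>min (k - i) (k - 1 - j)\<close> carry the weight \<open>q powi (m\<^sup>2 + m)\<close>, and the \<open>max (i - 1 - j) 0\<close> others
  the weight \<open>q powi m\<^sup>2\<close>.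
\<close>

definition partial_summand :: "int \<Rightarrow> int \<Rightarrow> int \<Rightarrow> int \<Rightarrow> (int \<Rightarrow> int) \<Rightarrow> 'a" where
  "partial_summand n k i j m = prefix_product q n i j m *
     bosonic_sum' (min (k - i) (k - 1 - j)) (max (i - 1 - j) 0)
       (n - (\<Sum>l=1..j. m l) - alpha i j) (m j)"

lemma partial_summand_fun_upd:
  fixes n k i j v :: int and m :: "int \<Rightarrow> int"
  assumes "1 \<le> j"
  defines "e \<equiv> of_bool (i \<le> j + 1) :: int" and "L \<equiv> n - (\<Sum>l=1..j. m l) - alpha i j"
  shows "partial_summand n k i (j + 1) (m(j + 1 := v)) = prefix_product q n i j m *
    (q powi (v\<^sup>2 + e * v) * qbinom' (2 * L + m j - v) (m j - v) *
     bosonic_sum' (min (k - i) (k - 1 - (j + 1))) (max (i - 1 - (j + 1)) 0) (L - e - v) v)"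
proof -
  define m' where "m' = m(j + 1 := v)"
  have m': "m' (j + 1) = v" "\<And>l. l \<le> j \<Longrightarrow> m' l = m l"
    by (simp_all add: m'_def)
  have sum: "(\<Sum>l=1..j. m' l) = (\<Sum>l=1..j. m l)"
    by (rule sum.cong) (simp_all add: m')
  have "prefix_product q n i j m' = prefix_product q n i j m"
    by (rule prefix_product_cong) (rule m')
  then have "prefix_product q n i (j + 1) m' = prefix_product q n i j m *
      (q powi (v\<^sup>2 + e * v) * qbinom' (2 * L + m j - v) (m j - v))"
    by (simp only: prefix_product_Suc[OF assms(1)] m' order.refl sum e_def L_def)
  moreover have "n - (\<Sum>l=1..j+1. m' l) - alpha i (j + 1) = L - e - v"
    using sum assms(1) by (simp add: atLeastAtMost_insert_right_int alpha_def m' e_def L_def)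
  ultimately show ?thesis
    unfolding m'_def[symmetric] partial_summand_def by (simp only: m' mult.assoc)
qed

lemma partial_summand_step:
  assumes "1 \<le> j" "j + 1 \<le> k - 1" "i \<le> k" "0 \<le> m j"
  shows "(\<Sum>v=0..m j. partial_summand n k i (j + 1) (m(j + 1 := v))) = partial_summand n k i j m"
proof -
  let ?s = "min (k - i) (k - 1 - (j + 1))" and ?t = "max (i - 1 - (j + 1)) 0"
  let ?e = "of_bool (i \<le> j + 1) :: int" and ?L = "n - (\<Sum>l=1..j. m l) - alpha i j"
  have "(\<Sum>v=0..m j. partial_summand n k i (j + 1) (m(j + 1 := v))) =
      prefix_product q n i j m * (\<Sum>v=0..m j. q powi (v\<^sup>2 + ?e * v) *
        qbinom' (2 * ?L + m j - v) (m j - v) * bosonic_sum' ?s ?t (?L - ?e - v) v)"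
    by (simp only: partial_summand_fun_upd[OF assms(1)] sum_distrib_left)
  also have "(\<Sum>v=0..m j. q powi (v\<^sup>2 + ?e * v) * qbinom' (2 * ?L + m j - v) (m j - v) *
      bosonic_sum' ?s ?t (?L - ?e - v) v) = bosonic_sum' (?s + ?e) (?t + 1 - ?e) ?L (m j)"
    by (rule bosonic_sum'_step) (use assms in auto)
  also have "?s + ?e = min (k - i) (k - 1 - j)"
    using assms by auto
  also have "?t + 1 - ?e = max (i - 1 - j) 0"
    by auto
  finally show ?thesis
    unfolding partial_summand_def[of n k i j m] .
qed

lemma sum_partial_summand:
  assumes "i \<le> k" "1 \<le> j" "j \<le> k - 1"
  shows "(\<Sum>m\<in>bounded_tuples B j. partial_summand n k i j m) =
    (\<Sum>v=0..B. partial_summand n k i 1 ((\<lambda>_. undefined)(1 := v)))"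
  using assms(2,3)
proof (induction j rule: int_ge_induct)
  case base
  show ?case by (rule sum_bounded_tuples_1)
next
  case (step j)
  have "(\<Sum>m\<in>bounded_tuples B (j + 1). partial_summand n k i (j + 1) m) =
      (\<Sum>m\<in>bounded_tuples B j. \<Sum>v=0..m j. partial_summand n k i (j + 1) (m(j + 1 := v)))"
    by (rule sum_bounded_tuples_Suc) (rule step.hyps)
  also have "\<dots> = (\<Sum>m\<in>bounded_tuples B j. partial_summand n k i j m)"
    by (intro sum.cong refl partial_summand_step) (use assms(1) step bounded_tuples_nonneg in auto)
  finally show ?case
    using step by simp
qed

lemma partial_summand_1:
  assumes "2 \<le> k" "1 \<le> i" "i \<le> k"
  shows "partial_summand n k i 1 ((\<lambda>_. undefined)(1 := v)) =
    q powi (v\<^sup>2 + of_bool (i = 1) * v) *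
    bosonic_sum' (k - i - of_bool (i = 1)) (i - 2 + of_bool (i = 1)) (n - of_bool (i = 1) - v) v"
  using assms
  by (cases "i = 1") (simp_all add: partial_summand_def prefix_product_def alpha_def algebra_simps)

lemma partial_summand_last:
  assumes "2 \<le> k" "i \<le> k" "m \<in> decreasing_tuples (k - 1)"
  shows "partial_summand n k i (k - 1) m = fermionic_summand q n k i m"
proof -
  have "(\<Sum>l=1..k-1. m l) = (\<Sum>l=1..k-2. m l) + m (k - 1)"
    using atLeastAtMost_insert_right_int[of 1 "k - 2"] assms(1) by simp
  then have "n - (\<Sum>l=1..k-1. m l) - alpha i (k - 1) + m (k - 1) = n - (\<Sum>l=1..k-2. m l) - k + i"
    using assms(2) by (simp add: alpha_def)
  moreover have "0 \<le> m (k - 1)"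
    using assms by (auto simp: decreasing_tuples_def PiE_iff)
  moreover have "min (k - i) (k - 1 - (k - 1)) = 0" "max (i - 1 - (k - 1)) 0 = 0"
    using assms by simp_all
  ultimately show ?thesis
    using assms(3) by (simp only: partial_summand_def fermionic_summand_eq bosonic_sum'_0_0)
qed

lemma bosonic_summand_eq:
  "bosonic_summand q n k i r =
    (-1) powi r * q powi bosonic_exponent (k - i) (i - 1) r *
      qbinom (2 * n) (n - upper_shift (k - i) i r)"
proof -
  have "r * (k * r + k - i) = bosonic_exponent (k - i) (i - 1) r"
    by (simp add: bosonic_exponent_def algebra_simps power2_eq_square)
  moreover have "n - k * r + (k - i) * (((-1) ^ nat \<bar>r\<bar> - 1) div 2) = n - upper_shift (k - i) i r"
    by (cases "even r") (simp_all add: upper_shift_def even_ceil_def even_nat_iff algebra_simps)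
  ultimately show ?thesis
    by (simp only: bosonic_summand_def)
qed

theorem Sum_any_fermionic_eq_bosonic:
  assumes "0 \<le> n" "2 \<le> k" "1 \<le> i" "i \<le> k"
  shows "Sum_any (fermionic_summand q n k i) = Sum_any (bosonic_summand q n k i)"
proof -
  define e :: int where "e = of_bool (i = 1)"
  have "{m. fermionic_summand q n k i m \<noteq> 0} \<subseteq> decreasing_tuples (k - 1)"
    by (auto simp: fermionic_summand_def)
  then obtain B where B: "n \<le> B"
    and restrict: "Sum_any (fermionic_summand q n k i) =
      sum (fermionic_summand q n k i) (bounded_tuples B (k - 1))"
    using Sum_any_eq_sum_bounded_tuples[of "k - 1" "fermionic_summand q n k i" n]
      finite_fermionic_summand[of n k i q] assms by auto
  note restrict
  also have "\<dots> = (\<Sum>m\<in>bounded_tuples B (k - 1). partial_summand n k i (k - 1) m)"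
    using assms by (intro sum.cong refl) (simp add: partial_summand_last bounded_tuples_def)
  also have "\<dots> = (\<Sum>v=0..B. partial_summand n k i 1 ((\<lambda>_. undefined)(1 := v)))"
    by (rule sum_partial_summand) (use assms in auto)
  also have "\<dots> = (\<Sum>v=0..B. q powi (v\<^sup>2 + e * v) *
      bosonic_sum' (k - i - e) (i - 2 + e) (n - e - v) v)"
    unfolding partial_summand_1[OF assms(2,3,4)] e_def ..
  also have "\<dots> = (\<Sum>b. (-1) powi b *
      q powi bosonic_exponent (k - i - e + e) (i - 2 + e + 1 - e) b *
      qbinom (2 * n) (n - upper_shift (k - i - e + e) (i - 2 + e + 2 - e) b))"
    by (rule sum_bosonic_sum') (use assms B in \<open>auto simp: e_def\<close>)
  also have "\<dots> = Sum_any (bosonic_summand q n k i)"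
    by (simp add: bosonic_summand_eq)
  finally show ?thesis .
qed

end

section \<open>The case q = 0\<close>

lemma q_pochhammer_base_0 [simp]: "q_pochhammer 0 0 m = (1::'a::field)"
  by (simp add: q_pochhammer_def)

lemma q_binomial_base_0: "q_binomial (0::'a::field) a b = (if 0 \<le> b \<and> b \<le> a then 1 else 0)"
  by (simp add: q_binomial_def)

lemma q_binomial'_base_0: "q_binomial' (0::'a::field) a 0 = 1"
  by (simp add: q_binomial'_def q_binomial_base_0)

lemma fermionic_summand_base_0:
  assumes "2 \<le> k" "1 \<le> i"
  shows "fermionic_summand (0::'a::field) n k i m = (if m = (\<lambda>j\<in>{1..k-1}. 0) then 1 else 0)"
proof (cases "m \<in> decreasing_tuples (k - 1)")
  case decreasing: True
  then have ext: "m \<in> extensional {1..k-1}" and nonneg: "\<And>j. j \<in> {1..k-1} \<Longrightarrow> 0 \<le> m j"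
    by (auto simp: decreasing_tuples_def PiE_iff)
  show ?thesis
  proof (cases "\<forall>j\<in>{1..k-1}. m j = 0")
    case zero: True
    then have "m = (\<lambda>j\<in>{1..k-1}. 0)"
      using ext by (auto intro: extensionalityI)
    moreover have "linking_factor 0 n i m j = (1::'a)" if "j \<in> {1..k-2}" for j
      using zero that by (simp add: linking_factor_def q_binomial'_base_0)
    ultimately show ?thesis
      using decreasing zero assms
      by (simp add: fermionic_summand_eq prefix_product_def q_binomial'_base_0)
  next
    case False
    then obtain j where j: "j \<in> {1..k-1}" "m j \<noteq> 0" by blast
    have "0 < (\<Sum>j=1..k-1. (m j)\<^sup>2)"
      by (rule sum_pos2[OF _ j(1)]) (use j in auto)
    moreover have "0 \<le> (\<Sum>j=i..k-1. m j)"
      by (rule sum_nonneg) (use nonneg assms in auto)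
    ultimately have "fermionic_summand (0::'a) n k i m = 0"
      by (simp add: fermionic_summand_def power_int_0_left_if)
    moreover have "m \<noteq> (\<lambda>j\<in>{1..k-1}. 0)"
      using j by auto
    ultimately show ?thesis by simp
  qed
next
  case False
  then have "m \<noteq> (\<lambda>j\<in>{1..k-1}. 0)"
    by (auto simp: decreasing_tuples_def monotone_on_def)
  with False show ?thesis by (simp add: fermionic_summand_def)
qed

lemma bosonic_summand_base_0:
  assumes "0 \<le> n" "1 \<le> i" "i \<le> k"
  shows "bosonic_summand (0::'a::field) n k i r = (if r = 0 then 1 else 0)"
proof (cases "r = 0")
  case True
  with assms show ?thesis by (simp add: bosonic_summand_def q_binomial_base_0)
next
  case False
  have "k * r + k - i \<noteq> 0"
  proof (cases "0 < r")
    case True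
    with assms have "0 < k * r" by simp
    with assms show ?thesis by linarith
  next
    case False
    with assms \<open>r \<noteq> 0\<close> have "k * (r + 1) \<le> 0" by (intro mult_nonneg_nonpos) auto
    with assms show ?thesis by (simp add: distrib_left)
  qed
  with False show ?thesis by (simp add: bosonic_summand_def power_int_0_left_if)
qed

theorem theorem1p7:
  fixes q :: "'a::field" and n k i :: int
  assumes "\<And>m::nat. m > 0 \<Longrightarrow> q ^ m \<noteq> 1"
    and "n \<ge> 0" and "k \<in> {2, 3, 4}" and "k \<ge> i" and "i \<ge> 1"
  shows "Sum_any (\<lambda>m :: int \<Rightarrow> int.
           if m \<in> decreasing_tuples (k - 1) then
             q powi ((\<Sum>j=1..k-1. (m j)\<^sup>2) + (\<Sum>j=i..k-1. m j)) *
             q_binomial' (q\<^sup>2) (n - (\<Sum>j=1..k-2. m j) - k + i) (m (k - 1)) *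
             (\<Prod>j=1..k-2. q_binomial' q
                (2 * n - 2 * (\<Sum>l=1..j-1. m l) - m j - m (j + 1) - 2 * alpha i j)
                (m j - m (j + 1)))
           else 0)
       = Sum_any (\<lambda>r :: int.
           (-1) powi r * q powi (r * (k * r + k - i)) *
           q_binomial q (2 * n) (n - k * r + (k - i) * (((-1) ^ nat \<bar>r\<bar> - 1) div 2)))"
proof -
  have k: "2 \<le> k" using assms(3) by auto
  have "Sum_any (fermionic_summand q n k i) = Sum_any (bosonic_summand q n k i)"
  proof (cases "q = 0")
    case True
    with k assms show ?thesis
      by (simp add: fermionic_summand_base_0 bosonic_summand_base_0)
  next
    case False
    interpret generic_base q
      by unfold_locales (use False assms(1) in auto)
    show ?thesis
      using assms k by (intro Sum_any_fermionic_eq_bosonic)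
  qed
  then show ?thesis
    unfolding fermionic_summand_def bosonic_summand_def .
qed

end
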